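(* Let $p>1$ and let $(\xi_n)_{n\ge 1}\subset Sub_{\varphi_p}$ be a sequence of $\varphi_p$-subgaussian random variables (defined on a common probability space; no independence is assumed). If there exist positive constants $c$ and $\alpha$ such that for every natural number $n\ge 1$ $$\tau_{\varphi_p}\Big(\sum_{i=1}^n\xi_i\Big)\le c\,n^{1-\alpha},$$ then $n^{-1}\sum_{i=1}^n\xi_i$ converges almost surely to $0$ as $n\to\infty$.
   Context: For $p\ge 1$ the function $\varphi_p:\mathbb{R}\to\mathbb{R}$ is defined by $\varphi_p(x)=\frac{x^2}{2}$ if $|x|\le 1$ and $\varphi_p(x)=\frac{1}{p}|x|^p-\frac{1}{p}+\frac{1}{2}$ if $|x|>1$. For a real random variable $\xi$ put $$\tau_{\varphi_p}(\xi)=\inf\{a\ge 0:\ \forall \lambda\in\mathbb{R}\ \ \ln\mathbb{E}\exp(\lambda\xi)\le\varphi_p(a\lambda)\}$$ (with $\inf\emptyset=\infty$). The space of $\varphi_p$-subgaussian random variables is $Sub_{\varphi_p}=\{\xi:\ \tau_{\varphi_p}(\xi)<\infty\}$, and $\tau_{\varphi_p}$ is a norm on it. *)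

theory Defs
  imports "HOL-Probability.Probability"
begin

definition phi :: "real \<Rightarrow> real \<Rightarrow> real" where
  "phi p x = (if \<bar>x\<bar> \<le> 1 then x\<^sup>2 / 2 else (1 / p) * \<bar>x\<bar> powr p - 1 / p + 1 / 2)"

(* The Bochner integral of a non-integrable function is 0, so finiteness of
   E exp(l * xi) is required explicitly: if it is infinite, then so is its logarithm
   and the inequality fails.  The infimum is taken in ereal, where Inf {} = \<infinity>. *)
definition tau :: "'a measure \<Rightarrow> real \<Rightarrow> ('a \<Rightarrow> real) \<Rightarrow> ereal" where
  "tau M p \<xi> = Inf (ereal ` {a. 0 \<le> a \<and>
     (\<forall>l. integrable M (\<lambda>\<omega>. exp (l * \<xi> \<omega>)) \<and>
          ln (\<integral>\<omega>. exp (l * \<xi> \<omega>) \<partial>M) \<le> phi p (a * l))})"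

definition Sub_phi :: "'a measure \<Rightarrow> real \<Rightarrow> ('a \<Rightarrow> real) set" where
  "Sub_phi M p = {\<xi> \<in> borel_measurable M. tau M p \<xi> < \<infinity>}"

end

theory Submission
  imports Defs "HOL-Real_Asymp.Real_Asymp"
begin

text \<open>
  If \<open>b\<close> exceeds the norm \<open>tau M p X\<close>, then both \<open>X / b\<close> and \<open>- X / b\<close> have exponential
  moment at most \<open>exp (1 / 2)\<close>, because \<open>phi p\<close> is at most \<open>1 / 2\<close> on \<open>[-1, 1]\<close>.  By Chernoff's
  bound, the tail \<open>\<bar>X\<bar> \<ge> t\<close> then has probability at most a constant times \<open>exp (- t / b)\<close>
  (\<open>tail_of_tau_less\<close>).

  Let \<open>S n\<close> be the partial sums, whose norms are at most \<open>c * n powr (1 - \<alpha>)\<close>.  At the level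
  \<open>t = n powr (1 - \<alpha> / 2)\<close>, which lies half way (in the exponent) between the size of the norm
  and \<open>n\<close>, the tail of \<open>S n\<close> is bounded by a constant times \<open>exp (- n powr (\<alpha> / 2) / (2 * c))\<close>.
  These bounds are summable, however small \<open>\<alpha>\<close> is (\<open>summable_stretched_exp\<close>), so the
  convergence half of the Borel-Cantelli lemma shows that almost surely
  \<open>\<bar>S n\<bar> / n < n powr (- \<alpha> / 2)\<close> for all large \<open>n\<close>.  Because the level depends on \<open>n\<close> and is
  already \<open>o(n)\<close>, a single exceptional null set covers all accuracies at once.
\<close>

lemma phi_le_half:
  assumes "\<bar>x\<bar> \<le> 1"
  shows "phi p x \<le> 1 / 2"
  using assms abs_square_le_1[of x] by (simp add: phi_def)

text \<open>
  The strict inequality supplies an admissible \<open>a < b\<close> directly, without asking whether the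
  infimum in \<open>tau\<close> is attained.  Taking \<open>l = s / b\<close> keeps \<open>a * l\<close> in \<open>[-1, 1]\<close>, where
  \<open>phi p\<close> has a bound that depends on neither \<open>a\<close> nor \<open>p\<close>.
\<close>

lemma exp_moment_of_tau_less:
  assumes tau: "tau M p X < ereal b" and "0 < b" and s: "\<bar>s\<bar> \<le> 1"
  shows "integrable M (\<lambda>\<omega>. exp (s / b * X \<omega>))"
    and "(\<integral>\<omega>. exp (s / b * X \<omega>) \<partial>M) \<le> exp (1 / 2)"
proof -
  obtain a where a: "0 \<le> a" "a < b"
    and int: "\<And>l. integrable M (\<lambda>\<omega>. exp (l * X \<omega>))"
    and mgf: "\<And>l. ln (\<integral>\<omega>. exp (l * X \<omega>) \<partial>M) \<le> phi p (a * l)"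
    using tau unfolding tau_def Inf_less_iff by auto
  show "integrable M (\<lambda>\<omega>. exp (s / b * X \<omega>))"
    by (rule int)
  have "\<bar>a * (s / b)\<bar> = a / b * \<bar>s\<bar>"
    using a \<open>0 < b\<close> by (simp add: abs_mult)
  also have "\<dots> \<le> 1 * 1"
    using a \<open>0 < b\<close> s by (intro mult_mono) auto
  finally have ln: "ln (\<integral>\<omega>. exp (s / b * X \<omega>) \<partial>M) \<le> 1 / 2"
    using mgf[of "s / b"] phi_le_half[of "a * (s / b)" p] by simp
  have "0 \<le> (\<integral>\<omega>. exp (s / b * X \<omega>) \<partial>M)"
    by (intro Bochner_Integration.integral_nonneg) simp
  \<comment> \<open>A vanishing integral, whose logarithm is 0 by convention, satisfies the bound trivially.\<close>
  then show "(\<integral>\<omega>. exp (s / b * X \<omega>) \<partial>M) \<le> exp (1 / 2)"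
    using ln by (metis exp_ge_zero exp_le_cancel_iff exp_ln order_le_less)
qed

lemma (in prob_space) tail_of_tau_less:
  assumes tau: "tau M p X < ereal b" and "0 < b" and [measurable]: "X \<in> borel_measurable M"
  shows "prob {\<omega> \<in> space M. t \<le> \<bar>X \<omega>\<bar>} \<le> 2 * exp (1 / 2) * exp (- (t / b))"
proof -
  note moment = exp_moment_of_tau_less[OF tau \<open>0 < b\<close>]
  have set_int: "set_integrable M (space M) (\<lambda>\<omega>. exp (s / b * X \<omega>))" if "\<bar>s\<bar> \<le> 1" for s
    unfolding set_integrable_def by (intro integrable_mult_indicator moment that) auto
  have "prob {\<omega> \<in> space M. t \<le> X \<omega>} \<le> exp (- (1 / b) * t) * expectation (\<lambda>\<omega>. exp (1 / b * X \<omega>))"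
    using Chernoff_ineq_ge[of "1 / b" "space M" X t] \<open>0 < b\<close> set_int[of 1] moment(1)[of 1]
    by (simp add: set_integral_space)
  also have "\<dots> \<le> exp (- (1 / b) * t) * exp (1 / 2)"
    using moment(2)[of 1] by (intro mult_left_mono) auto
  finally have upper: "prob {\<omega> \<in> space M. t \<le> X \<omega>} \<le> exp (- (t / b)) * exp (1 / 2)"
    by simp
  have "prob {\<omega> \<in> space M. X \<omega> \<le> - t} \<le> exp (1 / b * - t) * expectation (\<lambda>\<omega>. exp (- (1 / b) * X \<omega>))"
    using Chernoff_ineq_le[of "1 / b" "space M" X "- t"] \<open>0 < b\<close> set_int[of "-1"] moment(1)[of "-1"]
    by (simp add: set_integral_space)
  also have "\<dots> \<le> exp (1 / b * - t) * exp (1 / 2)"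
    using moment(2)[of "-1"] by (intro mult_left_mono) auto
  finally have lower: "prob {\<omega> \<in> space M. X \<omega> \<le> - t} \<le> exp (- (t / b)) * exp (1 / 2)"
    by simp
  have "prob {\<omega> \<in> space M. t \<le> \<bar>X \<omega>\<bar>}
      \<le> prob ({\<omega> \<in> space M. t \<le> X \<omega>} \<union> {\<omega> \<in> space M. X \<omega> \<le> - t})"
    by (intro finite_measure_mono) auto
  also have "\<dots> \<le> prob {\<omega> \<in> space M. t \<le> X \<omega>} + prob {\<omega> \<in> space M. X \<omega> \<le> - t}"
    by (intro measure_Un_le) auto
  finally show ?thesis
    using upper lower by (simp add: mult.commute)
qed

lemma summable_stretched_exp:
  fixes k \<beta> :: real
  assumes "0 < k" "0 < \<beta>"
  shows "summable (\<lambda>n. exp (- (k * real n powr \<beta>)))"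
proof (rule summable_comparison_test_bigo)
  show "summable (\<lambda>n. norm (1 / real n ^ 2))"
    using inverse_power_summable[of 2, where 'a = real] by (simp add: field_simps)
  show "(\<lambda>n. exp (- (k * real n powr \<beta>))) \<in> O(\<lambda>n. 1 / real n ^ 2)"
    using assms by real_asymp
qed

theorem theorem2p2:
  fixes M :: "'a measure" and \<xi> :: "nat \<Rightarrow> 'a \<Rightarrow> real" and p :: real
  assumes "prob_space M"
    and "p > 1"
    and "\<And>n. n \<ge> 1 \<Longrightarrow> \<xi> n \<in> Sub_phi M p"
    and "\<exists>c \<alpha> :: real. c > 0 \<and> \<alpha> > 0 \<and>
      (\<forall>n\<ge>1. tau M p (\<lambda>\<omega>. \<Sum>i=1..n. \<xi> i \<omega>) \<le> ereal (c * real n powr (1 - \<alpha>)))"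
  shows "AE \<omega> in M. (\<lambda>n. (\<Sum>i=1..n. \<xi> i \<omega>) / real n) \<longlonglongrightarrow> 0"
proof -
  interpret prob_space M by fact
  obtain c \<alpha> :: real where "0 < c" "0 < \<alpha>"
    and tau: "\<And>n. n \<ge> 1 \<Longrightarrow>
      tau M p (\<lambda>\<omega>. \<Sum>i=1..n. \<xi> i \<omega>) \<le> ereal (c * real n powr (1 - \<alpha>))"
    using assms(4) by blast
  define S where "S n \<omega> = (\<Sum>i=1..n. \<xi> i \<omega>)" for n \<omega>
  define A where "A n = {\<omega> \<in> space M. real n powr (1 - \<alpha> / 2) \<le> \<bar>S n \<omega>\<bar>}" for n
  have S_measurable [measurable]: "S n \<in> borel_measurable M" for n
    unfolding S_def using assms(3) by (intro borel_measurable_sum) (auto simp: Sub_phi_def)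
  have A_sets [measurable]: "A n \<in> sets M" for n
    unfolding A_def by measurable
  have prob_A: "prob (A n) \<le> 2 * exp (1 / 2) * exp (- (1 / (2 * c) * real n powr (\<alpha> / 2)))"
    if "n \<ge> 1" for n
  proof -
    \<comment> \<open>The factor 2 turns the assumed non-strict bound into a strict one.\<close>
    define b where "b = 2 * c * real n powr (1 - \<alpha>)"
    have "0 < b"
      using \<open>0 < c\<close> that by (simp add: b_def)
    have "tau M p (S n) \<le> ereal (b / 2)"
      using tau[OF that] by (simp add: S_def[abs_def] b_def)
    also have "\<dots> < ereal b"
      using \<open>0 < b\<close> by simp
    finally have "prob (A n) \<le> 2 * exp (1 / 2) * exp (- (real n powr (1 - \<alpha> / 2) / b))"
      unfolding A_def using \<open>0 < b\<close> by (intro tail_of_tau_less) auto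
    also have "real n powr (1 - \<alpha> / 2) / b
        = 1 / (2 * c) * (real n powr (1 - \<alpha> / 2) / real n powr (1 - \<alpha>))"
      by (simp add: b_def)
    also have "real n powr (1 - \<alpha> / 2) / real n powr (1 - \<alpha>) = real n powr (\<alpha> / 2)"
      by (simp flip: powr_diff)
    finally show ?thesis .
  qed
  have "summable (\<lambda>n. 2 * exp (1 / 2) * exp (- (1 / (2 * c) * real n powr (\<alpha> / 2))))"
    using \<open>0 < c\<close> \<open>0 < \<alpha>\<close> by (intro summable_mult summable_stretched_exp) auto
  then have "summable (\<lambda>n. prob (A n))"
    by (rule summable_comparison_test'[where N = 1]) (use prob_A in auto)
  then have "AE \<omega> in M. eventually (\<lambda>n. \<omega> \<in> space M - A n) sequentially"
    by (intro borel_cantelli_AE1) (auto simp: emeasure_eq_measure)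
  then show ?thesis
  proof (eventually_elim)
    case (elim \<omega>)
    have "eventually (\<lambda>n. norm (S n \<omega> / real n) \<le> real n powr (- (\<alpha> / 2))) sequentially"
      using elim eventually_ge_at_top[of 1]
    proof eventually_elim
      case (elim n)
      then have "\<bar>S n \<omega>\<bar> / real n \<le> real n powr (1 - \<alpha> / 2) / real n powr 1"
        by (auto simp: A_def intro!: divide_right_mono)
      also have "\<dots> = real n powr (- (\<alpha> / 2))"
        by (simp only: powr_diff[symmetric]) simp
      finally show ?case
        by simp
    qed
    moreover have "(\<lambda>n. real n powr (- (\<alpha> / 2))) \<longlonglongrightarrow> 0"
      using \<open>0 < \<alpha>\<close> by real_asymp
    ultimately have "(\<lambda>n. S n \<omega> / real n) \<longlonglongrightarrow> 0"
      by (rule Lim_null_comparison)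
    then show ?case
      by (simp add: S_def)
  qed
qed

end
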